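(* Let the setting, iteration, constants and Assumption A of the context hold. Suppose that $$D:=2\omega(1-\lambda_{\max})(1-\eta)-\Omega^2L^2-\kappa^2-\tau^{-1}\Omega(2+M)(1+\eta)>0$$ and $\sum_{k=0}^{\infty}\lambda_k\le\lambda<\infty$ for some constant $\lambda$. Then, if $\|y_i^\delta-y_i^\dagger\|>0$ for all $i\in\{0,1,\dots,P-1\}$, the stopping index $\hat k_\delta$ of the modified discrepancy rule is almost surely finite, i.e. $\mathbb P(\hat k_\delta=\infty)=0$; moreover $\hat k_\delta\to\infty$ as $\delta\to0$.
   Context: Setting. $U,Y_0,\dots,Y_{P-1}$ are Hilbert spaces, $Y^P=Y_0\times\cdots\times Y_{P-1}$ has the natural inner product. $F_i:\mathfrak D(F_i)\subset U\to Y_i$ are (nonlinear) Fréchet differentiable operators with derivative $F_i'(u)$ and adjoint $F_i'(u)^*$; $F=(F_0,\dots,F_{P-1})$. Exact data $y^\dagger=(y_0^\dagger,\dots,y_{P-1}^\dagger)\in Y^P$; noisy data $y^\delta=(y_0^\delta,\dots,y_{P-1}^\delta)\in Y^P$ with $\|y_i^\delta-y_i^\dagger\|\le\delta_i$ and $\delta=\sqrt{\delta_0^2+\cdots+\delta_{P-1}^2}$, so $\|y^\delta-y^\dagger\|\le\delta$. $B_r(u)$ is the closed ball in $U$ of radius $r$ centred at $u$. Iteration (IRSGD). With initial guess $u_0^\delta=u_0\in U$, $$u_{k+1}^\delta=u_k^\delta-\omega_kF_{i_k}'(u_k^\delta)^*(F_{i_k}(u_k^\delta)-y_{i_k}^\delta)-\lambda_k(u_k^\delta-u_0),\quad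 k\ge0,$$ where $0<\omega\le\omega_k\le\Omega$, $0\le\lambda_k\le\lambda_{\max}<\tfrac12$, and the indices $i_k$ are drawn independently and uniformly at random from $\{0,\dots,P-1\}$. $\mathcal F_k$ is the $\sigma$-algebra generated by $i_n$, $0\le n<k$; $\mathbb P$ and $\mathbb E$ refer to this randomness. Constants. $\rho>0$, $\kappa\in(0,1)$, $\tau>1$, $a\ge1$, and $\varrho>0$ is sufficiently small, meaning $(1-\lambda_{\max})^2<\frac1{1+\varrho}$. With $L,\eta$ from Assumption A, $$c(\rho)=\rho\lambda_{\max}\frac{(1-\lambda_{\max})+\sqrt{(1-\lambda_{\max})^2+\left(\frac1{1+\varrho}-(1-\lambda_{\max})^2\right)(1+\kappa^{-2}\Omega^2L^2)}}{\frac1{1+\varrho}-(1-\lambda_{\max})^2},\qquad M=\frac{\varrho\,c(\rho)^2\,\tau}{\Omega(1+\varrho)(1+\eta)}.$$ Assumption A. (i) $F$ is continuous. (ii) There is a constant $0<L\le\frac1{2\omega}$ with $\|F_i'(u)\|\le L$ for all $u\in B_{\rho+c(\rho)}(u_0)$ and all $i$, and a constant $0<\eta<1$ with $\|F_i(\bar u)-F_i(u)-F_i'(u)(\bar u-u)\|\le\eta\|F_i(\bar u)-F_i(u)\|$ for all $u,\bar u\in B_{\rho+c(\rho)}(u_0)$ and all $i$. (iii) $F(u)=y^\dagger$ has a solution $\hat u\in B_\rho(u_0)$. Modified discrepancy rule. $\hat k_\delta$ is the smallest integer such that $$\|F_i(u^\delta_{\hat k_\delta})-y_i^\delta\|+\frac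 M{\hat k_\delta+a}\le\tau\|y_i^\delta-y_i^\dagger\|<\|F_i(u_k^\delta)-y_i^\delta\|+\frac M{k+a}\quad\forall i=0,\dots,P-1,$$ for all $0\le k<\hat k_\delta$. The event $\{\hat k_\delta=\infty\}$ is the event that $\|F_i(u_k^\delta)-y_i^\delta\|+\frac M{k+a}>\tau\|y_i^\delta-y_i^\dagger\|$ for all $i=0,\dots,P-1$ and all integers $k\ge0$. *)

theory Defs
  imports "HOL-Probability.Probability" "HOL-Library.Extended_Nat"
begin

text \<open>
  The Hilbert spaces \<open>Y i\<close> are closed subspaces of one ambient Hilbert space of type \<open>'y\<close>.  This is
  no restriction, since a finite family of Hilbert spaces embeds isometrically into its direct sum,
  and it allows them to differ from one another.  \<open>F i\<close> is a total HOL function that is meaningful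
  on its domain only.  \<open>adjoint\<close> is the library's Hilbert space adjoint; restricted to \<open>Y i\<close>, the
  adjoint of a map into the ambient space is the adjoint of the same map regarded as a map into
  \<open>Y i\<close>.
\<close>

definition c_rho :: "real \<Rightarrow> real \<Rightarrow> real \<Rightarrow> real \<Rightarrow> real \<Rightarrow> real \<Rightarrow> real" where
  "c_rho \<rho> lam_max varrho \<kappa> \<Omega> L =
     \<rho> * lam_max *
     ((1 - lam_max) +
      sqrt ((1 - lam_max)\<^sup>2 +
            (1 / (1 + varrho) - (1 - lam_max)\<^sup>2) * (1 + \<Omega>\<^sup>2 * L\<^sup>2 / \<kappa>\<^sup>2)))
     / (1 / (1 + varrho) - (1 - lam_max)\<^sup>2)"

definition M_const :: "real \<Rightarrow> real \<Rightarrow> real \<Rightarrow> real \<Rightarrow> real \<Rightarrow> real" where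
  "M_const varrho c \<tau> \<Omega> \<eta> = varrho * c\<^sup>2 * \<tau> / (\<Omega> * (1 + varrho) * (1 + \<eta>))"

text \<open>The iterates along one realisation \<open>i\<close> of the random index sequence.\<close>

primrec irsgd ::
  "(nat \<Rightarrow> 'u \<Rightarrow> 'y) \<Rightarrow> (nat \<Rightarrow> 'u \<Rightarrow> 'u \<Rightarrow> 'y) \<Rightarrow> (nat \<Rightarrow> real) \<Rightarrow> (nat \<Rightarrow> real) \<Rightarrow>
   'u::real_inner \<Rightarrow> (nat \<Rightarrow> 'y::real_inner) \<Rightarrow> (nat \<Rightarrow> nat) \<Rightarrow> nat \<Rightarrow> 'u" where
  "irsgd F F' om lam u0 yd i 0 = u0"
| "irsgd F F' om lam u0 yd i (Suc k) =
     (let u = irsgd F F' om lam u0 yd i k in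
      u - om k *\<^sub>R adjoint (F' (i k) u) (F (i k) u - yd (i k)) - lam k *\<^sub>R (u - u0))"

definition noisy_data ::
  "nat \<Rightarrow> (nat \<Rightarrow> 'y::real_inner set) \<Rightarrow> (nat \<Rightarrow> 'y) \<Rightarrow> (nat \<Rightarrow> real) \<Rightarrow> (nat \<Rightarrow> 'y) \<Rightarrow> bool" where
  "noisy_data P Y yt dl yd \<longleftrightarrow> (\<forall>i<P. yd i \<in> Y i \<and> norm (yd i - yt i) \<le> dl i)"

definition stops_at ::
  "nat \<Rightarrow> (nat \<Rightarrow> 'u \<Rightarrow> 'y::real_inner) \<Rightarrow> (nat \<Rightarrow> 'y) \<Rightarrow> (nat \<Rightarrow> 'y) \<Rightarrow>
   real \<Rightarrow> real \<Rightarrow> real \<Rightarrow> (nat \<Rightarrow> 'u) \<Rightarrow> nat \<Rightarrow> bool" where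
  "stops_at P F yt yd \<tau> M a u n \<longleftrightarrow>
     (\<forall>i<P. norm (F i (u n) - yd i) + M / (real n + a) \<le> \<tau> * norm (yd i - yt i)) \<and>
     (\<forall>k<n. \<forall>i<P. \<tau> * norm (yd i - yt i) < norm (F i (u k) - yd i) + M / (real k + a))"

definition never_stops ::
  "nat \<Rightarrow> (nat \<Rightarrow> 'u \<Rightarrow> 'y::real_inner) \<Rightarrow> (nat \<Rightarrow> 'y) \<Rightarrow> (nat \<Rightarrow> 'y) \<Rightarrow>
   real \<Rightarrow> real \<Rightarrow> real \<Rightarrow> (nat \<Rightarrow> 'u) \<Rightarrow> bool" where
  "never_stops P F yt yd \<tau> M a u \<longleftrightarrow>
     (\<forall>i<P. \<forall>k. norm (F i (u k) - yd i) + M / (real k + a) > \<tau> * norm (yd i - yt i))"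

text \<open>
  The modified discrepancy rule.  Infinite means that the criterion is violated for all components
  at all indices, which is not the negation of \<open>\<exists>n. stops_at \<dots> n\<close>: if, at the first index where
  some component meets the criterion, another one does not, then no index qualifies and yet the
  event of an infinite stopping index does not occur.  The rule assigns no value to such paths;
  this is encoded by \<open>None\<close>.
\<close>

definition khat ::
  "nat \<Rightarrow> (nat \<Rightarrow> 'u \<Rightarrow> 'y::real_inner) \<Rightarrow> (nat \<Rightarrow> 'y) \<Rightarrow> (nat \<Rightarrow> 'y) \<Rightarrow>
   real \<Rightarrow> real \<Rightarrow> real \<Rightarrow> (nat \<Rightarrow> 'u) \<Rightarrow> enat option" where
  "khat P F yt yd \<tau> M a u =
     (if \<exists>n. stops_at P F yt yd \<tau> M a u n
      then Some (enat (LEAST n. stops_at P F yt yd \<tau> M a u n))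
      else if never_stops P F yt yd \<tau> M a u then Some \<infinity>
      else None)"

end

theory Submission
  imports Defs "HOL-Real_Asymp.Real_Asymp"
begin

text \<open>
  No realisation at all runs forever.  While the criterion is violated for every component, the
  noise level of the selected component is at most \<open>1/\<tau>\<close> times its residual \<open>r\<^sub>k\<close> plus
  \<open>M/(k+a)\<close>, so one step changes the squared error \<open>x\<^sub>k = \<parallel>u\<^sub>k - uhat\<parallel>\<^sup>2\<close> by at most \<open>-D r\<^sub>k\<^sup>2\<close>
  plus terms proportional to \<open>\<lambda>\<^sub>k\<close> and \<open>1/(k+1)\<^sup>2\<close>.  The bound
  \<open>x\<^sub>k \<le> c\<^sup>2 - (1 - \<lambda>\<^sub>m\<^sub>a\<^sub>x) h / (k + 1/2)\<close> with \<open>h = \<Omega> M (1 + \<eta>) / \<tau>\<close> is preserved, which keeps the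
  iterates in the ball where Assumption A applies; the simpler bound \<open>x\<^sub>k \<le> c\<^sup>2\<close> is not inductive,
  because for \<open>\<lambda>\<^sub>k = 0\<close> nothing compensates the term \<open>1/(k+1)\<^sup>2\<close>.  Summing the steps gives
  \<open>\<Sum>r\<^sub>k\<^sup>2 < \<infinity>\<close>, hence \<open>r\<^sub>k + M/(k+a) \<rightarrow> 0\<close>, contradicting the positive lower bound given by the
  violated criterion.  For the second claim, stopping at \<open>n\<close> forces \<open>M/(n+a) \<le> \<tau> \<delta>\<close>, where \<open>M > 0\<close>.
\<close>

section \<open>Riesz representation and Hilbert space adjoints\<close>

text \<open>The representing vector is the minimiser of
  \<open>Q x = x \<bullet> x - 2 * f x\<close>: minimising sequences are Cauchy by the parallelogram
  law, and the first variation of \<open>Q\<close> vanishes at the limit.\<close>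

lemma riesz_representation:
  fixes f :: "'u::{real_inner, banach} \<Rightarrow> real"
  assumes "bounded_linear f"
  shows "\<exists>z. \<forall>x. f x = x \<bullet> z"
proof -
  interpret bounded_linear f by fact
  define Q where "Q x = x \<bullet> x - 2 * f x" for x
  have bdd: "bdd_below (range Q)"
  proof -
    obtain B where B: "\<And>x. norm (f x) \<le> norm x * B" using bounded by blast
    have "- B\<^sup>2 \<le> Q x" for x
    proof -
      have "0 \<le> (norm x - B)\<^sup>2" by simp
      then show ?thesis using B[of x]
        by (simp add: Q_def power2_norm_eq_inner power2_diff)
    qed
    then show ?thesis by (meson bdd_belowI2)
  qed
  define m where "m = Inf (range Q)"
  have m_le: "m \<le> Q x" for x unfolding m_def using bdd by (simp add: cInf_lower)
  have "\<exists>x. Q x < m + inverse (real (Suc n))" for n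
  proof -
    have "Inf (range Q) < m + inverse (real (Suc n))" unfolding m_def by simp
    then show ?thesis using cInf_lessD[of "range Q"] by blast
  qed
  then obtain X where X: "\<And>n. Q (X n) < m + inverse (real (Suc n))" by metis
  \<comment> \<open>Parallelogram law; the linear parts of \<open>Q\<close> cancel. With two values
    below \<open>m + e\<^sup>2 / 4\<close> and the midpoint value at least \<open>m\<close>, the
    right-hand side falls below \<open>e\<^sup>2\<close>.\<close>
  have par: "(norm (x - y))\<^sup>2 = 2 * Q x + 2 * Q y - 4 * Q ((1/2) *\<^sub>R (x + y))" for x y
    unfolding Q_def power2_norm_eq_inner
    by (simp add: scaleR add inner_simps inner_commute algebra_simps)
  have "Cauchy X"
  proof (rule metric_CauchyI)
    fix e :: real assume "0 < e"
    then obtain N where N: "inverse (real (Suc N)) < e\<^sup>2 / 4"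
      using reals_Archimedean[of "e\<^sup>2 / 4"] by auto
    have "dist (X p) (X q) < e" if "p \<ge> N" "q \<ge> N" for p q
    proof -
      have *: "Q (X j) < m + e\<^sup>2 / 4" if "j \<ge> N" for j
      proof -
        have "inverse (real (Suc j)) \<le> inverse (real (Suc N))"
          using that by (intro le_imp_inverse_le) auto
        with X[of j] N show ?thesis by linarith
      qed
      have "(norm (X p - X q))\<^sup>2 < e\<^sup>2"
        unfolding par using *[OF that(1)] *[OF that(2)] m_le[of "(1/2) *\<^sub>R (X p + X q)"] by linarith
      then show ?thesis using \<open>0 < e\<close> by (simp add: dist_norm power2_less_imp_less)
    qed
    then show "\<exists>M. \<forall>p\<ge>M. \<forall>q\<ge>M. dist (X p) (X q) < e" by blast
  qed
  then obtain z where z: "X \<longlonglongrightarrow> z" using Cauchy_convergent convergent_def by blast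
  have "(\<lambda>n. Q (X n)) \<longlonglongrightarrow> Q z" unfolding Q_def by (intro tendsto_intros z tendsto)
  moreover have "(\<lambda>n. m + inverse (real (Suc n))) \<longlonglongrightarrow> m + 0"
    by (intro tendsto_intros LIMSEQ_inverse_real_of_nat)
  ultimately have "Q z \<le> m + 0"
    by (rule LIMSEQ_le) (use X less_imp_le in blast)
  then have min: "Q z \<le> Q x" for x using m_le[of x] by linarith
  have "f h = h \<bullet> z" for h
  proof (cases "h = 0")
    case False
    define g where "g = h \<bullet> z - f h"
    \<comment> \<open>The minimiser of \<open>Q\<close> along the line through \<open>z\<close> in
      direction \<open>h\<close>; since \<open>z\<close> already minimises \<open>Q\<close>, this
      forces \<open>g = 0\<close>.\<close>
    define t where "t = - g / (h \<bullet> h)"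
    have hh: "h \<bullet> h > 0" using False by simp
    have "Q (z + t *\<^sub>R h) = Q z + 2 * t * g + t\<^sup>2 * (h \<bullet> h)"
      by (simp add: Q_def g_def add scaleR inner_simps inner_commute algebra_simps power2_eq_square)
    with min[of "z + t *\<^sub>R h"] have "0 \<le> 2 * t * g + t\<^sup>2 * (h \<bullet> h)" by linarith
    also have "\<dots> = - g\<^sup>2 / (h \<bullet> h)"
      using hh by (simp add: t_def power2_eq_square field_simps)
    finally have "g\<^sup>2 \<le> 0" using hh by (simp add: field_simps)
    then show ?thesis by (simp add: g_def)
  qed (simp add: zero)
  then show ?thesis by blast
qed

text \<open>\<open>adjoint\<close> is defined by choice, so its characteristic equation needs a
  witness, which Riesz supplies for each \<open>y\<close>. Only the domain has to be
  complete.\<close>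

lemma adjoint_works_banach:
  fixes A :: "'u::{real_inner, banach} \<Rightarrow> 'y::real_inner"
  assumes "bounded_linear A"
  shows "A x \<bullet> y = x \<bullet> adjoint A y"
proof -
  have "\<forall>y. \<exists>z. \<forall>x. A x \<bullet> y = x \<bullet> z"
    using riesz_representation bounded_linear_compose[OF bounded_linear_inner_left assms] by blast
  then have "\<exists>g. \<forall>x y. A x \<bullet> y = x \<bullet> g y" by metis
  then have "\<forall>x y. A x \<bullet> y = x \<bullet> adjoint A y" unfolding adjoint_def by (rule someI_ex)
  then show ?thesis by blast
qed

lemma norm_adjoint_le:
  fixes A :: "'u::{real_inner, banach} \<Rightarrow> 'y::real_inner"
  assumes "bounded_linear A"
  shows "norm (adjoint A y) \<le> onorm A * norm y"
proof (cases "adjoint A y = 0")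
  case True
  then show ?thesis using onorm_pos_le[OF assms] by simp
next
  case False
  have "norm (adjoint A y) * norm (adjoint A y) = A (adjoint A y) \<bullet> y"
    by (simp add: adjoint_works_banach[OF assms] norm_eq_sqrt_inner)
  also have "\<dots> \<le> norm (A (adjoint A y)) * norm y" by (rule norm_cauchy_schwarz)
  also have "\<dots> \<le> onorm A * norm (adjoint A y) * norm y"
    by (intro mult_right_mono onorm[OF assms]) auto
  finally show ?thesis using False by (simp add: mult.assoc mult.left_commute[of "onorm A"])
qed

section \<open>Change of the squared error in one step\<close>

text \<open>The new error is \<open>p - w *\<^sub>R g\<close> with \<open>p\<close> a convex
  combination of the old error \<open>e\<close> and the initial error \<open>f\<close>. Expanding
  the square moves the adjoint onto \<open>p\<close>: the part \<open>A e \<bullet> R\<close> yields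
  descent by the tangential cone condition, the part \<open>A f \<bullet> R\<close> is only bounded
  and carries the factor \<open>l\<close>.\<close>

lemma irsgd_step_error:
  fixes A :: "'u::{real_inner, banach} \<Rightarrow> 'y::real_inner" and y yd Fu :: 'y and u u0 uhat :: 'u
  assumes A: "bounded_linear A" "onorm A \<le> L"
    and cone: "norm (y - Fu - A (uhat - u)) \<le> \<eta> * norm (y - Fu)" "0 \<le> \<eta>"
    and w: "0 \<le> w" and l: "0 \<le> l" "l \<le> 1"
    and \<rho>: "norm (u0 - uhat) \<le> \<rho>"
  defines "r \<equiv> norm (Fu - yd)" and "d \<equiv> norm (yd - y)"
  shows "(norm (u - w *\<^sub>R adjoint A (Fu - yd) - l *\<^sub>R (u - u0) - uhat))\<^sup>2
    \<le> ((1 - l) * norm (u - uhat) + l * \<rho>)\<^sup>2 - 2 * w * (1 - l) * ((1 - \<eta>) * r\<^sup>2 - (1 + \<eta>) * d * r)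
      + 2 * w * l * L * \<rho> * r + w\<^sup>2 * L\<^sup>2 * r\<^sup>2"
proof -
  define R e f g where "R = Fu - yd" and "e = u - uhat" and "f = u0 - uhat" and "g = adjoint A R"
  define p where "p = (1 - l) *\<^sub>R e + l *\<^sub>R f"
  have r: "norm R = r" by (simp add: R_def r_def)
  have L: "0 \<le> L" using A onorm_pos_le order_trans by blast
  have "norm p \<le> (1 - l) * norm e + l * \<rho>"
    unfolding p_def using l \<rho> by (intro norm_triangle_le add_mono) (auto simp: f_def mult_left_mono)
  then have p: "(norm p)\<^sup>2 \<le> ((1 - l) * norm e + l * \<rho>)\<^sup>2" by (simp add: power_mono)
  have "norm g \<le> onorm A * r" using norm_adjoint_le[OF A(1), of R] by (simp add: g_def r)
  also have "\<dots> \<le> L * r" using A(2) by (simp add: mult_right_mono r_def)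
  finally have g: "(norm g)\<^sup>2 \<le> L\<^sup>2 * r\<^sup>2" by (metis norm_ge_zero power_mono power_mult_distrib)
  have "\<bar>A f \<bullet> R\<bar> \<le> norm (A f) * norm R" by (rule Cauchy_Schwarz_ineq2)
  also have "\<dots> \<le> L * \<rho> * r"
  proof -
    have "norm (A f) \<le> onorm A * norm f" by (rule onorm[OF A(1)])
    also have "\<dots> \<le> L * \<rho>" using A(2) \<rho> L by (intro mult_mono) (auto simp: f_def)
    finally show ?thesis by (simp add: r mult_right_mono r_def)
  qed
  finally have f: "- (L * \<rho> * r) \<le> A f \<bullet> R" by simp
  \<comment> \<open>The linearisation error. It splits \<open>A e\<close> into residual, noise and
    \<open>q\<close>, where \<open>q\<close> is at most \<open>\<eta> * (d + r)\<close>.\<close>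
  define q where "q = A e - (Fu - y)"
  have "q = y - Fu - A (uhat - u)"
    unfolding q_def e_def by (simp add: linear_diff[OF bounded_linear.linear[OF A(1)]] algebra_simps)
  then have "norm q \<le> \<eta> * norm (y - Fu)" using cone by simp
  also have "\<dots> \<le> \<eta> * (d + r)"
  proof -
    have "y - Fu = - (yd - y) - (Fu - yd)" by simp
    then have "norm (y - Fu) \<le> d + r"
      unfolding d_def r_def by (metis norm_minus_cancel norm_triangle_ineq4)
    then show ?thesis using cone(2) by (simp add: mult_left_mono)
  qed
  finally have q: "norm q \<le> \<eta> * (d + r)" .
  have e: "(1 - \<eta>) * r\<^sup>2 - (1 + \<eta>) * d * r \<le> A e \<bullet> R"
  proof -
    have "A e \<bullet> R = R \<bullet> R + (yd - y) \<bullet> R + q \<bullet> R"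
      by (simp add: q_def R_def inner_simps algebra_simps)
    moreover have "\<bar>(yd - y) \<bullet> R\<bar> \<le> d * r"
      using Cauchy_Schwarz_ineq2[of "yd - y" R] by (simp add: d_def r)
    moreover have "\<bar>q \<bullet> R\<bar> \<le> \<eta> * (d + r) * r"
      using Cauchy_Schwarz_ineq2[of q R] q mult_right_mono[OF q, of r] by (simp add: r r_def)
    moreover have "R \<bullet> R = r\<^sup>2" using r by (metis power2_norm_eq_inner)
    ultimately show ?thesis by (simp add: algebra_simps power2_eq_square)
  qed
  have eq: "u - w *\<^sub>R adjoint A (Fu - yd) - l *\<^sub>R (u - u0) - uhat = p - w *\<^sub>R g"
    by (simp add: p_def e_def f_def g_def R_def algebra_simps)
  have "(norm (p - w *\<^sub>R g))\<^sup>2 = (norm p)\<^sup>2 - 2 * w * (p \<bullet> g) + w\<^sup>2 * (norm g)\<^sup>2"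
    unfolding power2_norm_eq_inner
    by (simp add: inner_simps inner_commute algebra_simps power2_eq_square)
  also have "p \<bullet> g = (1 - l) * (A e \<bullet> R) + l * (A f \<bullet> R)"
    by (simp add: p_def g_def inner_simps adjoint_works_banach[OF A(1)])
  finally have "(norm (p - w *\<^sub>R g))\<^sup>2 = (norm p)\<^sup>2 - 2 * w * (1 - l) * (A e \<bullet> R)
      + 2 * w * l * (- (A f \<bullet> R)) + w\<^sup>2 * (norm g)\<^sup>2"
    by (simp add: algebra_simps)
  moreover have "2 * w * (1 - l) * ((1 - \<eta>) * r\<^sup>2 - (1 + \<eta>) * d * r) \<le> 2 * w * (1 - l) * (A e \<bullet> R)"
    using w l e by (intro mult_left_mono) auto
  moreover have "2 * w * l * (- (A f \<bullet> R)) \<le> 2 * w * l * (L * \<rho> * r)"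
    using w l f by (intro mult_left_mono) auto
  then have "2 * w * l * (- (A f \<bullet> R)) \<le> 2 * w * l * L * \<rho> * r" by (simp only: mult.assoc)
  moreover have "w\<^sup>2 * (norm g)\<^sup>2 \<le> w\<^sup>2 * (L\<^sup>2 * r\<^sup>2)" using g by (intro mult_left_mono) auto
  then have "w\<^sup>2 * (norm g)\<^sup>2 \<le> w\<^sup>2 * L\<^sup>2 * r\<^sup>2" by (simp only: mult.assoc)
  ultimately show ?thesis unfolding eq e_def[symmetric] using p by linarith
qed

text \<open>The violated criterion bounds the noise \<open>d\<close> by
  \<open>(r + M * q) / \<tau>\<close>, and Young's inequality splits the two mixed terms, in
  \<open>l * r\<close> and in \<open>q * r\<close>. The resulting coefficients of
  \<open>r\<^sup>2\<close> are those collected in \<open>D\<close>: its summand \<open>2 + M\<close>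
  consists of \<open>2\<close> from the pure residual part of the noise and \<open>M\<close> from
  the mixed term.\<close>

lemma step_error_constants:
  fixes w l :: real
  assumes w: "0 < \<omega>" "\<omega> \<le> w" "w \<le> \<Omega>" and l: "0 \<le> l" "l \<le> lmax" "lmax < 1"
    and nn: "0 \<le> r" "0 \<le> q" "0 \<le> M" "0 < \<kappa>" "0 < \<tau>" "0 \<le> \<eta>" "\<eta> < 1" "0 \<le> D"
    and d: "\<tau> * d \<le> r + M * q"
    and D: "2 * \<omega> * (1 - lmax) * (1 - \<eta>) - \<Omega>\<^sup>2 * L\<^sup>2 - \<kappa>\<^sup>2 - (1 / \<tau>) * \<Omega> * (2 + M) * (1 + \<eta>) = D"
  shows "- (2 * w * (1 - l) * ((1 - \<eta>) * r\<^sup>2 - (1 + \<eta>) * d * r)) + 2 * w * l * L * \<rho> * r + w\<^sup>2 * L\<^sup>2 * r\<^sup>2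
    \<le> l\<^sup>2 * \<rho>\<^sup>2 * (\<Omega>\<^sup>2 * L\<^sup>2 / \<kappa>\<^sup>2) + (1 - l) * (1 - lmax) * (\<Omega> * (1 + \<eta>) / \<tau> * M) * q\<^sup>2 - D * r\<^sup>2"
proof -
  define s h v V where "s = \<Omega> * (1 + \<eta>) / \<tau>" and "h = s * M" and "v = 1 - l" and "V = 1 - lmax"
  have v: "0 < V" "V \<le> v" "v \<le> 1" using l by (auto simp: v_def V_def)
  have s: "0 \<le> s" and h: "0 \<le> h" using w nn by (auto simp: s_def h_def)
  have a: "2 * w * v * ((1 + \<eta>) * d * r) \<le> 2 * s * v * r\<^sup>2 + 2 * v * h * q * r"
  proof -
    have "d \<le> (r + M * q) / \<tau>" using d nn by (simp add: field_simps)
    then have "2 * w * v * ((1 + \<eta>) * d * r) \<le> 2 * w * v * ((1 + \<eta>) * ((r + M * q) / \<tau>) * r)"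
      using w v nn by (intro mult_left_mono mult_right_mono) auto
    also have "\<dots> \<le> 2 * \<Omega> * v * ((1 + \<eta>) * ((r + M * q) / \<tau>) * r)"
      using w v nn by (intro mult_right_mono) auto
    also have "\<dots> = 2 * s * v * r\<^sup>2 + 2 * v * h * q * r"
      using nn by (simp add: s_def h_def field_simps power2_eq_square)
    finally show ?thesis .
  qed
  \<comment> \<open>Young's inequality with weight \<open>\<kappa>\<close>; the
    \<open>l\<^sup>2\<close> term is the one that enters the equation for
    \<open>c_rho\<close>.\<close>
  have b: "2 * w * l * L * \<rho> * r \<le> \<kappa>\<^sup>2 * r\<^sup>2 + l\<^sup>2 * \<rho>\<^sup>2 * (\<Omega>\<^sup>2 * L\<^sup>2 / \<kappa>\<^sup>2)"
  proof -
    have "0 \<le> (\<kappa> * r - w * l * L * \<rho> / \<kappa>)\<^sup>2" by simp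
    also have "\<dots> = \<kappa>\<^sup>2 * r\<^sup>2 - 2 * w * l * L * \<rho> * r + l\<^sup>2 * \<rho>\<^sup>2 * (w\<^sup>2 * L\<^sup>2 / \<kappa>\<^sup>2)"
      using nn by (simp add: power2_eq_square field_simps)
    also have "l\<^sup>2 * \<rho>\<^sup>2 * (w\<^sup>2 * L\<^sup>2 / \<kappa>\<^sup>2) \<le> l\<^sup>2 * \<rho>\<^sup>2 * (\<Omega>\<^sup>2 * L\<^sup>2 / \<kappa>\<^sup>2)"
      using w by (intro mult_left_mono divide_right_mono mult_right_mono power_mono) auto
    finally show ?thesis by simp
  qed
  have c: "w\<^sup>2 * L\<^sup>2 * r\<^sup>2 \<le> \<Omega>\<^sup>2 * L\<^sup>2 * r\<^sup>2"
    using w by (intro mult_right_mono power_mono) auto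
  \<comment> \<open>The weight \<open>V\<close> in Young's inequality leaves
    \<open>q\<^sup>2\<close> with the factor \<open>v * V * h\<close>, as the later invariant
    requires; the price is the factor \<open>v / V\<close> at \<open>r\<^sup>2\<close>.\<close>
  have e: "2 * v * h * q * r \<le> v / V * h * r\<^sup>2 + v * V * h * q\<^sup>2"
  proof -
    have "0 \<le> v * h / V * (r - V * q)\<^sup>2" using v h by auto
    also have "\<dots> = v / V * h * r\<^sup>2 + v * V * h * q\<^sup>2 - 2 * v * h * q * r"
      using v by (simp add: power2_eq_square field_simps)
    finally show ?thesis by simp
  qed
  \<comment> \<open>\<open>D\<close> is formed with the worst case \<open>V\<close>, the step has
    \<open>v\<close>. Multiplying the defining equation of \<open>D\<close> by \<open>v / V\<close>,
    which is at least 1, absorbs the factor from Young's inequality.\<close>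
  have "D + \<Omega>\<^sup>2 * L\<^sup>2 + \<kappa>\<^sup>2 + 2 * s * v + v / V * h \<le> 2 * w * v * (1 - \<eta>)"
  proof -
    have one: "1 \<le> v / V" using v by (simp add: field_simps)
    have sv: "2 * s * v \<le> v / V * (2 * s)"
    proof -
      have "v \<le> v / V" using v by (simp add: field_simps mult_le_one)
      then show ?thesis using s mult_right_mono[of v "v / V" "2 * s"] by (simp add: mult_ac)
    qed
    have "D + \<Omega>\<^sup>2 * L\<^sup>2 + \<kappa>\<^sup>2 \<le> v / V * (D + \<Omega>\<^sup>2 * L\<^sup>2 + \<kappa>\<^sup>2)"
      using one nn mult_right_mono[OF one, of "D + \<Omega>\<^sup>2 * L\<^sup>2 + \<kappa>\<^sup>2"] by simp
    then have "D + \<Omega>\<^sup>2 * L\<^sup>2 + \<kappa>\<^sup>2 + 2 * s * v + v / V * h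
        \<le> v / V * (D + \<Omega>\<^sup>2 * L\<^sup>2 + \<kappa>\<^sup>2 + 2 * s + h)"
      using sv by (simp add: distrib_left)
    also have "D + \<Omega>\<^sup>2 * L\<^sup>2 + \<kappa>\<^sup>2 + 2 * s + h = 2 * \<omega> * V * (1 - \<eta>)"
      unfolding D[symmetric] s_def h_def V_def using nn by (simp add: field_simps)
    also have "v / V * (2 * \<omega> * V * (1 - \<eta>)) = 2 * \<omega> * v * (1 - \<eta>)" using v by simp
    also have "\<dots> \<le> 2 * w * v * (1 - \<eta>)" using w v nn by (intro mult_right_mono) auto
    finally show ?thesis .
  qed
  from mult_right_mono[OF this, of "r\<^sup>2"]
  have f: "D * r\<^sup>2 + \<Omega>\<^sup>2 * L\<^sup>2 * r\<^sup>2 + \<kappa>\<^sup>2 * r\<^sup>2 + 2 * s * v * r\<^sup>2 + v / V * h * r\<^sup>2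
      \<le> 2 * w * v * (1 - \<eta>) * r\<^sup>2"
    by (simp add: distrib_right)
  have "2 * w * v * ((1 - \<eta>) * r\<^sup>2 - (1 + \<eta>) * d * r)
      = 2 * w * v * (1 - \<eta>) * r\<^sup>2 - 2 * w * v * ((1 + \<eta>) * d * r)"
    by (simp add: right_diff_distrib mult.assoc)
  then show ?thesis
    unfolding s_def[symmetric] h_def[symmetric] v_def[symmetric] V_def[symmetric]
    using a b c e f by linarith
qed

section \<open>The radius \<open>c\<close> and the invariant error bound\<close>

text \<open>\<open>c_rho\<close> is the positive root of this quadratic equation.\<close>

lemma c_rho_fixed_point:
  assumes c: "c = c_rho \<rho> lmax varrho \<kappa> \<Omega> L" and "0 \<le> \<rho>" "0 < lmax" "lmax < 1"
    and "(1 - lmax)\<^sup>2 < 1 / (1 + varrho)"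
  shows "((1 - lmax) * c + lmax * \<rho>)\<^sup>2 + lmax\<^sup>2 * \<rho>\<^sup>2 * (\<Omega>\<^sup>2 * L\<^sup>2 / \<kappa>\<^sup>2) = c\<^sup>2 / (1 + varrho)"
proof -
  define V K g where "V = 1 - lmax" and "K = \<Omega>\<^sup>2 * L\<^sup>2 / \<kappa>\<^sup>2" and "g = 1 / (1 + varrho) - V\<^sup>2"
  define S where "S = sqrt (V\<^sup>2 + g * (1 + K))"
  define b where "b = \<rho> * lmax"
  have g: "0 < g" using assms by (simp add: g_def V_def)
  have K: "0 \<le> K" by (simp add: K_def)
  have S: "S\<^sup>2 = V\<^sup>2 + g * (1 + K)" unfolding S_def using g K by simp
  have c': "c = b * (V + S) / g"
    unfolding c c_rho_def S_def V_def g_def K_def b_def by simp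
  then have gc: "g * c = b * (V + S)" using g by simp
  have "g * (g * c\<^sup>2) = (g * c)\<^sup>2" by (simp add: power2_eq_square)
  also have "\<dots> = b\<^sup>2 * (V\<^sup>2 + 2 * V * S + S\<^sup>2)"
    unfolding gc by (simp add: power2_eq_square algebra_simps)
  also have "\<dots> = 2 * b * V * (b * (V + S)) + b\<^sup>2 * (g * (1 + K))"
    unfolding S by (simp add: power2_eq_square algebra_simps)
  also have "\<dots> = g * (2 * b * V * c + b\<^sup>2 * (1 + K))"
    unfolding gc[symmetric] by (simp add: algebra_simps)
  finally have "g * c\<^sup>2 = 2 * b * V * c + b\<^sup>2 * (1 + K)" using g by simp
  then have "c\<^sup>2 / (1 + varrho) = V\<^sup>2 * c\<^sup>2 + 2 * b * V * c + b\<^sup>2 * (1 + K)"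
    by (simp add: g_def algebra_simps)
  then show ?thesis
    unfolding V_def[symmetric] K_def[symmetric] b_def by (simp add: power2_eq_square algebra_simps)
qed

text \<open>Base case of the invariant, where \<open>1 / (0 + 1/2)\<close> produces the factor 2.
  With \<open>s = sqrt \<sigma>\<close> the hypothesis becomes
  \<open>(1 - V) * \<rho> \<le> (s - V) * c\<close>, which leaves a polynomial inequality in
  \<open>s\<close> and \<open>V\<close>.\<close>

lemma initial_error_bound:
  fixes V :: real
  assumes V: "1/2 < V" "V < 1" and \<sigma>: "V\<^sup>2 < \<sigma>" "\<sigma> < 1"
    and c: "0 < c" "0 \<le> \<rho>" "(V * c + (1 - V) * \<rho>)\<^sup>2 \<le> \<sigma> * c\<^sup>2"
  shows "\<rho>\<^sup>2 \<le> c\<^sup>2 - 2 * V * (1 - \<sigma>) * c\<^sup>2"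
proof -
  define s where "s = sqrt \<sigma>"
  have "0 \<le> \<sigma>" using \<sigma> zero_le_power2[of V] by linarith
  then have s2: "s\<^sup>2 = \<sigma>" and s: "V \<le> s" "s < 1"
    using real_le_rsqrt[of V \<sigma>] real_sqrt_less_mono[OF \<sigma>(2)] \<sigma>(1) by (simp_all add: s_def)
  have "(V * c + (1 - V) * \<rho>)\<^sup>2 \<le> (s * c)\<^sup>2" using c by (simp add: power_mult_distrib s2)
  then have "V * c + (1 - V) * \<rho> \<le> s * c"
    by (rule power2_le_imp_le) (use V s c in simp)
  then have "(1 - V) * \<rho> \<le> (s - V) * c" by (simp add: algebra_simps)
  then have "((1 - V) * \<rho>)\<^sup>2 \<le> ((s - V) * c)\<^sup>2" using V c by (intro power_mono) auto
  moreover have "(s - V)\<^sup>2 \<le> (1 - V)\<^sup>2 * (1 - 2 * V * (1 - s\<^sup>2))"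
  proof -
    have 1: "0 \<le> 1 - 2 * V * (1 - V\<^sup>2)"
    proof -
      have "1 - 2 * V * (1 - V\<^sup>2) = 1 - 2 * V + 2 * V ^ 3"
        by (simp add: algebra_simps power2_eq_square power3_eq_cube)
      \<comment> \<open>A cubic with a double root at \<open>1/2\<close>; it lies below the wanted
        one by \<open>(1 - V) / 2\<close>.\<close>
      moreover have "0 \<le> (V - 1/2)\<^sup>2 * (2 * V + 2)" using V by simp
      moreover have "(V - 1/2)\<^sup>2 * (2 * V + 2) = 2 * V ^ 3 - 3/2 * V + 1/2"
        by (simp add: algebra_simps power2_eq_square power3_eq_cube)
      ultimately show ?thesis using V by simp
    qed
    have 2: "0 \<le> 1 - 2 * V * (1 - V)"
    proof -
      have "1 - 2 * V * (1 - V) = V\<^sup>2 + (1 - V)\<^sup>2" by (simp add: algebra_simps power2_eq_square)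
      then show ?thesis by simp
    qed
    \<comment> \<open>The difference vanishes at \<open>s = 1\<close>. The cofactor of
      \<open>1 - s\<close> is affine in \<open>s\<close> and is written as an interpolation between
      \<open>s = V\<close> and \<open>s = 1\<close>, where it is nonnegative.\<close>
    have "(1 - V)\<^sup>2 * (1 - 2 * V * (1 - s\<^sup>2)) - (s - V)\<^sup>2
        = (1 - s) * ((1 - s) * (1 - 2 * V * (1 - V\<^sup>2)) + 2 * (s - V) * (1 - 2 * V * (1 - V)))"
      by (simp add: algebra_simps power2_eq_square)
    also have "\<dots> \<ge> 0" using 1 2 s V by auto
    finally show ?thesis by simp
  qed
  then have "((s - V) * c)\<^sup>2 \<le> (1 - V)\<^sup>2 * (1 - 2 * V * (1 - s\<^sup>2)) * c\<^sup>2"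
    by (simp add: power_mult_distrib mult_right_mono)
  ultimately have "(1 - V)\<^sup>2 * \<rho>\<^sup>2 \<le> (1 - V)\<^sup>2 * ((1 - 2 * V * (1 - \<sigma>)) * c\<^sup>2)"
    by (simp add: power_mult_distrib s2 mult.assoc)
  then have "\<rho>\<^sup>2 \<le> (1 - 2 * V * (1 - \<sigma>)) * c\<^sup>2" using V by simp
  then show ?thesis by (simp add: algebra_simps)
qed

text \<open>Convexity: the value at \<open>x\<close> is the interpolation of the endpoint values
  minus \<open>C * x * (m - x)\<close>.\<close>

lemma quadratic_le_endpoints:
  fixes A B C :: real
  assumes "0 \<le> C" "0 \<le> x" "x \<le> m" "0 < m" "A \<le> T" "A + B * m + C * m\<^sup>2 \<le> T"
  shows "A + B * x + C * x\<^sup>2 \<le> T"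
proof -
  have "m * (A + B * x + C * x\<^sup>2) = (m - x) * A + x * (A + B * m + C * m\<^sup>2) - C * m * x * (m - x)"
    by (simp add: algebra_simps power2_eq_square)
  also have "\<dots> \<le> (m - x) * T + x * T - 0"
    using assms by (intro diff_mono add_mono mult_left_mono) auto
  finally have "m * (A + B * x + C * x\<^sup>2) \<le> m * T" by (simp add: algebra_simps)
  then show ?thesis using assms by simp
qed

text \<open>
  The tail of \<open>\<Sum>1/(k+1)\<^sup>2\<close> is majorised by \<open>1/(k+1/2)\<close>.  The recursion is convex in the
  regularisation parameter, so only its extreme values matter: \<open>l = 0\<close> adds exactly the term
  accounted for by this majorant, and for \<open>l = lmax\<close> the fixed point equation leaves room for it.
\<close>

lemma error_bound_step:
  fixes V z :: real
  assumes V: "1/2 < V" "V < 1" and \<sigma>: "\<sigma> < 1" and nn: "0 \<le> z" "0 \<le> \<rho>" "0 \<le> c" "0 \<le> K"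
    and fp: "(V * c + (1 - V) * \<rho>)\<^sup>2 + (1 - V)\<^sup>2 * \<rho>\<^sup>2 * K = \<sigma> * c\<^sup>2"
    and l: "0 \<le> l" "l \<le> 1 - V"
  defines "h \<equiv> (1 - \<sigma>) * c\<^sup>2"
  assumes z: "z\<^sup>2 \<le> c\<^sup>2 - V * h / (real k + 1/2)"
  shows "((1 - l) * z + l * \<rho>)\<^sup>2 + l\<^sup>2 * \<rho>\<^sup>2 * K + (1 - l) * V * h * (1 / (real k + 1))\<^sup>2
    \<le> c\<^sup>2 - V * h / (real (Suc k) + 1/2)"
proof -
  define W W' Q where "W = 1 / (real k + 1/2)" and "W' = 1 / (real (Suc k) + 1/2)"
    and "Q = (1 / (real k + 1))\<^sup>2"
  define T where "T = c\<^sup>2 - V * h * W'"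
  have h: "0 \<le> h" using \<sigma> by (simp add: h_def)
  have pos: "0 \<le> W" by (simp add: W_def)
  have z': "z\<^sup>2 \<le> c\<^sup>2 - V * h * W" using z by (simp add: W_def)
  \<comment> \<open>The shift by \<open>1/2\<close> makes \<open>W - W'\<close> equal to
    \<open>1 / ((k + 1)\<^sup>2 - 1/4)\<close>, slightly more than \<open>Q\<close>.\<close>
  have QW: "Q + W' \<le> W"
  proof -
    have "W - W' = 1 / ((real k + 1)\<^sup>2 - 1/4)"
    proof -
      have *: "(real k + 1)\<^sup>2 - 1/4 = (real k + 1/2) * (real (Suc k) + 1/2)"
        by (simp add: power2_eq_square algebra_simps)
      show ?thesis unfolding W_def W'_def * by (simp add: divide_simps)
    qed
    moreover have "Q \<le> 1 / ((real k + 1)\<^sup>2 - 1/4)"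
    proof -
      have "1\<^sup>2 \<le> (real k + 1)\<^sup>2" by (intro power_mono) auto
      then show ?thesis unfolding Q_def power_divide power_one by (intro frac_le) linarith+
    qed
    ultimately show ?thesis by simp
  qed
  have low: "z\<^sup>2 + V * h * Q \<le> T"
  proof -
    have "V * h * (Q + W') \<le> V * h * W" using QW V h by (intro mult_left_mono) auto
    then show ?thesis using z' by (simp add: T_def distrib_left)
  qed
  \<comment> \<open>The case \<open>l = 1 - V\<close>. The gap \<open>h\<close> between
    \<open>c\<^sup>2\<close> and \<open>\<sigma> * c\<^sup>2\<close> pays for
    \<open>V * h * W'\<close>; the reserve in the bound on \<open>z\<^sup>2\<close> pays for the
    \<open>Q\<close> term, because \<open>Q\<close> is at most \<open>W / 2\<close> and
    \<open>1/2 < V\<close>.\<close>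
  have high: "(V * z + (1 - V) * \<rho>)\<^sup>2 + (1 - V)\<^sup>2 * \<rho>\<^sup>2 * K + V * V * h * Q \<le> T"
  proof -
    have "0 \<le> V * h * W" using V h pos by simp
    then have "z\<^sup>2 \<le> c\<^sup>2" using z' by linarith
    then have zc: "z \<le> c" using nn(3) by (rule power2_le_imp_le)
    have "V\<^sup>2 * z\<^sup>2 \<le> V\<^sup>2 * (c\<^sup>2 - V * h * W)" using z' by (intro mult_left_mono) auto
    moreover have "2 * V * (1 - V) * \<rho> * z \<le> 2 * V * (1 - V) * \<rho> * c"
      using zc V nn by (intro mult_left_mono) auto
    moreover have "(V * x + (1 - V) * \<rho>)\<^sup>2 = V\<^sup>2 * x\<^sup>2 + 2 * V * (1 - V) * \<rho> * x + ((1 - V) * \<rho>)\<^sup>2" for x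
      by (simp only: power2_sum power_mult_distrib mult_ac)
    ultimately have "(V * z + (1 - V) * \<rho>)\<^sup>2 \<le> (V * c + (1 - V) * \<rho>)\<^sup>2 - V\<^sup>2 * (V * h * W)"
      by (simp only: right_diff_distrib)
    moreover have "\<sigma> * c\<^sup>2 = c\<^sup>2 - h" by (simp add: h_def left_diff_distrib)
    ultimately have "(V * z + (1 - V) * \<rho>)\<^sup>2 + (1 - V)\<^sup>2 * \<rho>\<^sup>2 * K \<le> c\<^sup>2 - h - V\<^sup>2 * (V * h * W)"
      using fp by linarith
    moreover have "V * V * h * Q \<le> V\<^sup>2 * (V * h * W)"
    proof -
      have "Q \<le> 1/2 * W"
      proof -
        have "2 * (real k + 1/2) \<le> (real k + 1)\<^sup>2" by (simp add: power2_eq_square algebra_simps)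
        then have "1 / (real k + 1)\<^sup>2 \<le> 1 / (2 * (real k + 1/2))" by (intro frac_le) auto
        then show ?thesis by (simp add: Q_def W_def power_divide)
      qed
      also have "\<dots> \<le> V * W" using V pos by (intro mult_right_mono) auto
      finally have "V * V * h * Q \<le> V * V * h * (V * W)" using V h by (intro mult_left_mono) auto
      then show ?thesis by (simp add: power2_eq_square mult_ac)
    qed
    moreover have "V * h * W' \<le> h"
    proof -
      have "V * W' \<le> 1 * 1" using V by (intro mult_mono) (auto simp: W'_def)
      then show ?thesis using h mult_right_mono[of "V * W'" 1 h] by (simp add: mult_ac)
    qed
    ultimately show ?thesis unfolding T_def by linarith
  qed
  have expand: "((1 - x) * z + x * \<rho>)\<^sup>2 + x\<^sup>2 * \<rho>\<^sup>2 * K + (1 - x) * V * h * Q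
    = (z\<^sup>2 + V * h * Q) + (2 * z * (\<rho> - z) - V * h * Q) * x + ((\<rho> - z)\<^sup>2 + \<rho>\<^sup>2 * K) * x\<^sup>2" for x
    by (simp add: power2_eq_square algebra_simps)
  have "((1 - l) * z + l * \<rho>)\<^sup>2 + l\<^sup>2 * \<rho>\<^sup>2 * K + (1 - l) * V * h * Q \<le> T"
    unfolding expand
  proof (rule quadratic_le_endpoints[of _ _ "1 - V"])
    show "z\<^sup>2 + V * h * Q + (2 * z * (\<rho> - z) - V * h * Q) * (1 - V)
        + ((\<rho> - z)\<^sup>2 + \<rho>\<^sup>2 * K) * (1 - V)\<^sup>2 \<le> T"
      using high expand[of "1 - V"] by simp
  qed (use low l V nn in auto)
  then show ?thesis by (simp add: T_def Q_def W'_def)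
qed

section \<open>Summable residuals along one realisation\<close>

lemma summable_of_descent:
  fixes X b g :: "nat \<Rightarrow> real"
  assumes step: "\<And>k. X (Suc k) + g k \<le> X k + b k"
    and nn: "\<And>k. 0 \<le> X k" "\<And>k. 0 \<le> g k" "\<And>k. 0 \<le> b k" and b: "summable b"
  shows "summable g"
proof (rule summableI_nonneg_bounded)
  fix n
  have "X n + sum g {..<n} \<le> X 0 + sum b {..<n}"
  proof (induction n)
    case (Suc n)
    then show ?case using step[of n] by simp
  qed simp
  also have "\<dots> \<le> X 0 + suminf b" using b nn by (simp add: sum_le_suminf)
  finally show "sum g {..<n} \<le> X 0 + suminf b" using nn(1)[of n] by linarith
qed (use nn in auto)

lemma c_rho_pos:
  assumes "0 < \<rho>" "0 < lmax" "lmax < 1" "(1 - lmax)\<^sup>2 < 1 / (1 + varrho)"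
  shows "0 < c_rho \<rho> lmax varrho \<kappa> \<Omega> L"
proof -
  have "0 \<le> sqrt ((1 - lmax)\<^sup>2 + (1 / (1 + varrho) - (1 - lmax)\<^sup>2) * (1 + \<Omega>\<^sup>2 * L\<^sup>2 / \<kappa>\<^sup>2))"
    using assms by simp
  then show ?thesis
    unfolding c_rho_def using assms by (intro divide_pos_pos mult_pos_pos add_pos_nonneg) auto
qed

text \<open>Stated for an arbitrary index sequence \<open>j\<close>, so that it applies to every
  realisation and not merely to almost every one.\<close>

lemma irsgd_not_never_stops:
  fixes F :: "nat \<Rightarrow> 'u::{real_inner, banach} \<Rightarrow> 'y::real_inner" and j :: "nat \<Rightarrow> nat"
    and u0 uhat :: 'u and \<omega> \<Omega> lmax \<rho> \<kappa> \<tau> a varrho L \<eta> c M :: real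
  assumes j: "\<And>k. j k < P"
    and F': "\<And>i u. i < P \<Longrightarrow> u \<in> cball u0 (\<rho> + c) \<Longrightarrow> bounded_linear (F' i u)"
    and om: "0 < \<omega>" "\<And>k. \<omega> \<le> om k \<and> om k \<le> \<Omega>"
    and lam: "\<And>k. 0 \<le> lam k \<and> lam k \<le> lmax" "0 < lmax" "lmax < 1 / 2" "summable lam"
    and params: "0 < \<rho>" "0 < \<kappa>" "0 < \<tau>" "1 \<le> a"
    and varrho: "0 < varrho" "(1 - lmax)\<^sup>2 < 1 / (1 + varrho)"
    and c: "c = c_rho \<rho> lmax varrho \<kappa> \<Omega> L"
    and M: "M = M_const varrho c \<tau> \<Omega> \<eta>"
    and L: "\<And>i u. i < P \<Longrightarrow> u \<in> cball u0 (\<rho> + c) \<Longrightarrow> onorm (F' i u) \<le> L"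
    and \<eta>: "0 < \<eta>" "\<eta> < 1"
      "\<And>i u v. i < P \<Longrightarrow> u \<in> cball u0 (\<rho> + c) \<Longrightarrow> v \<in> cball u0 (\<rho> + c) \<Longrightarrow>
         norm (F i v - F i u - F' i u (v - u)) \<le> \<eta> * norm (F i v - F i u)"
    and sol: "uhat \<in> cball u0 \<rho>" "\<And>i. i < P \<Longrightarrow> F i uhat = yt i"
    and D: "0 < 2 * \<omega> * (1 - lmax) * (1 - \<eta>) - \<Omega>\<^sup>2 * L\<^sup>2 - \<kappa>\<^sup>2
                 - (1 / \<tau>) * \<Omega> * (2 + M) * (1 + \<eta>)"
    and noise: "\<And>i. i < P \<Longrightarrow> 0 < norm (yd i - yt i)"
  shows "\<not> never_stops P F yt yd \<tau> M a (irsgd F F' om lam u0 yd j)"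
proof
  assume never: "never_stops P F yt yd \<tau> M a (irsgd F F' om lam u0 yd j)"
  define u where "u = irsgd F F' om lam u0 yd j"
  define V \<sigma> K h where "V = 1 - lmax" and "\<sigma> = 1 / (1 + varrho)" and "K = \<Omega>\<^sup>2 * L\<^sup>2 / \<kappa>\<^sup>2"
    and "h = (1 - \<sigma>) * c\<^sup>2"
  define D where "D = 2 * \<omega> * (1 - lmax) * (1 - \<eta>) - \<Omega>\<^sup>2 * L\<^sup>2 - \<kappa>\<^sup>2
    - (1 / \<tau>) * \<Omega> * (2 + M) * (1 + \<eta>)"
  define z r q where "z k = norm (u k - uhat)" and "r k = norm (F (j k) (u k) - yd (j k))"
    and "q k = 1 / (real k + 1)" for k
  have cpos: "0 < c" unfolding c using params lam varrho by (intro c_rho_pos) auto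
  have \<Omega>: "0 < \<Omega>" using om(1) om(2)[of 0] by linarith
  have Mpos: "0 < M" unfolding M M_const_def using varrho cpos params \<Omega> \<eta> by simp
  have V: "1/2 < V" "V < 1" using lam by (auto simp: V_def)
  have \<sigma>: "V\<^sup>2 < \<sigma>" "\<sigma> < 1" using varrho by (auto simp: V_def \<sigma>_def)
  have h: "0 \<le> h" using \<sigma> by (simp add: h_def)
  have K: "0 \<le> K" by (simp add: K_def)
  \<comment> \<open>This explains the form of \<open>M\<close>: the noise coefficient equals the gap
    \<open>c\<^sup>2 - \<sigma> * c\<^sup>2\<close> left by the fixed point equation.\<close>
  have hM: "\<Omega> * (1 + \<eta>) / \<tau> * M = h"
    using \<Omega> \<eta> params varrho unfolding M M_const_def h_def \<sigma>_def by (simp add: divide_simps)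
  have fp: "(V * c + (1 - V) * \<rho>)\<^sup>2 + (1 - V)\<^sup>2 * \<rho>\<^sup>2 * K = \<sigma> * c\<^sup>2"
    using c_rho_fixed_point[OF c] params lam varrho by (simp add: V_def K_def \<sigma>_def)
  have uhat: "norm (u0 - uhat) \<le> \<rho>" using sol by (simp add: dist_norm)
  have uhat_ball: "uhat \<in> cball u0 (\<rho> + c)" using sol cpos by simp
  have stop: "\<tau> * norm (yd i - yt i) < norm (F i (u k) - yd i) + M / (real k + a)" if "i < P" for i k
    using never that by (auto simp: never_stops_def u_def)
  \<comment> \<open>Conditional on \<open>z k \<le> c\<close>, which places \<open>u k\<close> in
    the ball of radius \<open>\<rho> + c\<close> around \<open>u0\<close>; the invariant later
    discharges the condition.\<close>
  have step: "(z (Suc k))\<^sup>2 \<le> ((1 - lam k) * z k + lam k * \<rho>)\<^sup>2 + (lam k)\<^sup>2 * \<rho>\<^sup>2 * K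
      + (1 - lam k) * V * h * (q k)\<^sup>2 - D * (r k)\<^sup>2" if "z k \<le> c" for k
  proof -
    have "norm (u k - u0) \<le> norm (u k - uhat) + norm (u0 - uhat)"
      using norm_triangle_ineq4[of "u k - uhat" "u0 - uhat"] by simp
    then have ball: "u k \<in> cball u0 (\<rho> + c)"
      using that uhat by (simp add: z_def dist_norm norm_minus_commute)
    have "M / (real k + a) \<le> M * q k" using Mpos params by (simp add: q_def frac_le)
    then have d: "\<tau> * norm (yd (j k) - yt (j k)) \<le> r k + M * q k"
      using stop[OF j, of k k] by (simp add: r_def)
    have l: "0 \<le> lam k" "lam k \<le> lmax" "lam k \<le> 1" "lmax < 1" using lam(1)[of k] lam(3) by auto
    have w: "\<omega> \<le> om k" "om k \<le> \<Omega>" "0 \<le> om k" using om(1) om(2)[of k] by auto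
    have suc: "u (Suc k) = u k - om k *\<^sub>R adjoint (F' (j k) (u k)) (F (j k) (u k) - yd (j k))
        - lam k *\<^sub>R (u k - u0)"
      by (simp add: u_def Let_def)
    have cone: "norm (yt (j k) - F (j k) (u k) - F' (j k) (u k) (uhat - u k))
        \<le> \<eta> * norm (yt (j k) - F (j k) (u k))"
      using \<eta>(3)[OF j ball uhat_ball] sol(2)[OF j] by simp
    have "(z (Suc k))\<^sup>2 \<le> ((1 - lam k) * z k + lam k * \<rho>)\<^sup>2
        - 2 * om k * (1 - lam k) * ((1 - \<eta>) * (r k)\<^sup>2 - (1 + \<eta>) * norm (yd (j k) - yt (j k)) * r k)
        + 2 * om k * lam k * L * \<rho> * r k + (om k)\<^sup>2 * L\<^sup>2 * (r k)\<^sup>2"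
      unfolding z_def suc r_def
      using \<eta>(1) w l by (intro irsgd_step_error F'[OF j ball] L[OF j ball] cone uhat) auto
    moreover have "- (2 * om k * (1 - lam k)
          * ((1 - \<eta>) * (r k)\<^sup>2 - (1 + \<eta>) * norm (yd (j k) - yt (j k)) * r k))
        + 2 * om k * lam k * L * \<rho> * r k + (om k)\<^sup>2 * L\<^sup>2 * (r k)\<^sup>2
      \<le> (lam k)\<^sup>2 * \<rho>\<^sup>2 * (\<Omega>\<^sup>2 * L\<^sup>2 / \<kappa>\<^sup>2)
        + (1 - lam k) * (1 - lmax) * (\<Omega> * (1 + \<eta>) / \<tau> * M) * (q k)\<^sup>2 - D * (r k)\<^sup>2"
      using om(1) w l params Mpos \<eta> d D
      by (intro step_error_constants) (auto simp: r_def q_def D_def)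
    ultimately show ?thesis unfolding hM K_def V_def by linarith
  qed
  have Dr: "0 \<le> D * (r k)\<^sup>2" for k using D by (simp add: D_def)
  have invariant: "(z k)\<^sup>2 \<le> c\<^sup>2 - V * h / (real k + 1/2)" for k
  proof (induction k)
    case 0
    have "\<rho>\<^sup>2 \<le> c\<^sup>2 - 2 * V * (1 - \<sigma>) * c\<^sup>2"
    proof (rule initial_error_bound[OF V \<sigma> cpos])
      show "(V * c + (1 - V) * \<rho>)\<^sup>2 \<le> \<sigma> * c\<^sup>2" using fp K by (smt (verit) mult_nonneg_nonneg zero_le_power2)
    qed (use params in simp)
    moreover have "(z 0)\<^sup>2 \<le> \<rho>\<^sup>2" using uhat by (simp add: z_def u_def power_mono)
    ultimately show ?case by (simp add: h_def mult.assoc)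
  next
    case (Suc k)
    have "0 \<le> V * h / (real k + 1/2)" using V h by simp
    with Suc have "(z k)\<^sup>2 \<le> c\<^sup>2" by linarith
    then have "z k \<le> c" by (rule power2_le_imp_le) (use cpos in simp)
    from step[OF this] have "(z (Suc k))\<^sup>2 \<le> ((1 - lam k) * z k + lam k * \<rho>)\<^sup>2
      + (lam k)\<^sup>2 * \<rho>\<^sup>2 * K + (1 - lam k) * V * h * (1 / (real k + 1))\<^sup>2"
      using Dr[of k] by (simp add: q_def)
    also have "\<dots> \<le> c\<^sup>2 - V * h / (real (Suc k) + 1/2)"
      unfolding h_def using V \<sigma> params cpos K fp lam(1)[of k] Suc
      by (intro error_bound_step) (auto simp: z_def V_def h_def)
    finally show ?case .
  qed
  have zc: "z k \<le> c" for k
  proof -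
    have "0 \<le> V * h / (real k + 1/2)" using V h by simp
    with invariant[of k] have "(z k)\<^sup>2 \<le> c\<^sup>2" by linarith
    then show ?thesis by (rule power2_le_imp_le) (use cpos in simp)
  qed
  have "summable (\<lambda>k. D * (r k)\<^sup>2)"
  proof (rule summable_of_descent)
    fix k
    let ?l = "lam k"
    have l: "0 \<le> ?l" "?l \<le> 1" using lam(1)[of k] lam(3) by auto
    have z: "0 \<le> z k" by (simp add: z_def)
    have l2: "?l\<^sup>2 \<le> ?l" using l by (simp add: power2_eq_square mult_left_le)
    \<comment> \<open>With \<open>z k \<le> c\<close> and \<open>?l\<^sup>2 \<le> ?l\<close>, the
      growth caused by regularisation is at most a constant times \<open>lam k\<close>, hence
      summable.\<close>
    have "((1 - ?l) * z k + ?l * \<rho>)\<^sup>2 \<le> (z k + ?l * \<rho>)\<^sup>2"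
      using l z params by (intro power_mono add_mono) (auto simp: mult_left_le_one_le)
    also have "\<dots> = (z k)\<^sup>2 + ?l * (2 * \<rho> * z k) + ?l\<^sup>2 * \<rho>\<^sup>2"
      by (simp add: power2_eq_square algebra_simps)
    also have "\<dots> \<le> (z k)\<^sup>2 + ?l * (2 * \<rho> * c) + ?l * \<rho>\<^sup>2"
      using l l2 zc[of k] params by (intro add_mono mult_left_mono mult_right_mono) auto
    finally have 1: "((1 - ?l) * z k + ?l * \<rho>)\<^sup>2 \<le> (z k)\<^sup>2 + ?l * (2 * \<rho> * c) + ?l * \<rho>\<^sup>2" .
    have 2: "?l\<^sup>2 * \<rho>\<^sup>2 * K \<le> ?l * \<rho>\<^sup>2 * K" using l2 K by (intro mult_right_mono) auto
    have 3: "(1 - ?l) * V * h * (q k)\<^sup>2 \<le> 1 * V * h * (q k)\<^sup>2"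
      using l V h by (intro mult_right_mono) auto
    show "(z (Suc k))\<^sup>2 + D * (r k)\<^sup>2
        \<le> (z k)\<^sup>2 + (?l * (2 * \<rho> * c + \<rho>\<^sup>2 + \<rho>\<^sup>2 * K) + V * h * (q k)\<^sup>2)"
      using step[OF zc, of k] 1 2 3 by (simp add: distrib_left mult.assoc)
    show "0 \<le> ?l * (2 * \<rho> * c + \<rho>\<^sup>2 + \<rho>\<^sup>2 * K) + V * h * (q k)\<^sup>2"
      using l V h params cpos K by simp
  next
    have "summable (\<lambda>k. (q k)\<^sup>2)"
      using inverse_squares_sums by (auto simp: q_def power_divide sums_iff add.commute)
    then show "summable (\<lambda>k. lam k * (2 * \<rho> * c + \<rho>\<^sup>2 + \<rho>\<^sup>2 * K) + V * h * (q k)\<^sup>2)"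
      using lam(4) by (intro summable_add summable_mult summable_mult2)
  qed (use Dr in auto)
  then have "(\<lambda>k. D * (r k)\<^sup>2) \<longlonglongrightarrow> 0" by (rule summable_LIMSEQ_zero)
  from tendsto_mult_left[OF this, of "1 / D"] have "(\<lambda>k. (r k)\<^sup>2) \<longlonglongrightarrow> 0"
    using D by (simp add: D_def)
  moreover have "sqrt ((r k)\<^sup>2) = r k" for k by (simp add: r_def)
  ultimately have "r \<longlonglongrightarrow> 0" using tendsto_real_sqrt by fastforce
  moreover have "(\<lambda>k. M / (real k + a)) \<longlonglongrightarrow> 0" by real_asymp
  ultimately have lim: "(\<lambda>k. r k + M / (real k + a)) \<longlonglongrightarrow> 0 + 0" by (rule tendsto_add)
  \<comment> \<open>The selected component changes with \<open>k\<close>; the least of the finitely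
    many positive noise levels bounds them all from below.\<close>
  define m where "m = Min ((\<lambda>i. norm (yd i - yt i)) ` {..<P})"
  have P: "{..<P} \<noteq> {}" using j[of 0] by auto
  have "0 < m" unfolding m_def using noise P by (subst Min_gr_iff) auto
  have "\<tau> * m \<le> r k + M / (real k + a)" for k
  proof -
    have "m \<le> norm (yd (j k) - yt (j k))" unfolding m_def using j[of k] by (intro Min_le) auto
    then have "\<tau> * m \<le> \<tau> * norm (yd (j k) - yt (j k))" using params by simp
    then show ?thesis using stop[OF j, of k k] by (simp add: r_def)
  qed
  then have "\<tau> * m \<le> 0 + 0" using lim by (intro LIMSEQ_le_const[OF lim]) auto
  moreover have "0 < \<tau> * m" using \<open>0 < m\<close> params by simp
  ultimately show False by simp
qed

section \<open>The stopping index\<close>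

lemma khat_infinity_imp_never_stops:
  "khat P F yt yd \<tau> M a u = Some \<infinity> \<Longrightarrow> never_stops P F yt yd \<tau> M a u"
  by (auto simp: khat_def split: if_splits)

lemma khat_enat_imp_stops_at:
  "khat P F yt yd \<tau> M a u = Some (enat n) \<Longrightarrow> stops_at P F yt yd \<tau> M a u n"
  by (auto simp: khat_def split: if_splits intro: LeastI)

theorem theorem2p1:
  fixes P :: nat
    and Y :: "nat \<Rightarrow> 'y::{real_inner, banach} set"
    and dom :: "nat \<Rightarrow> 'u::{real_inner, banach} set"
    and F :: "nat \<Rightarrow> 'u \<Rightarrow> 'y"
    and F' :: "nat \<Rightarrow> 'u \<Rightarrow> 'u \<Rightarrow> 'y"
    and yt :: "nat \<Rightarrow> 'y"
    and u0 uhat :: 'u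
    and om lam :: "nat \<Rightarrow> real"
    and \<omega> \<Omega> lam_max lam_sum \<rho> \<kappa> \<tau> a varrho L \<eta> c M :: real
    and Pr :: "'w measure"
    and idx :: "nat \<Rightarrow> 'w \<Rightarrow> nat"
  assumes P: "P \<ge> 1"
    and Y: "\<And>i. i < P \<Longrightarrow> subspace (Y i) \<and> closed (Y i)"
    and F_range: "\<And>i u. i < P \<Longrightarrow> u \<in> dom i \<Longrightarrow> F i u \<in> Y i"
    and F'_range: "\<And>i u h. i < P \<Longrightarrow> u \<in> dom i \<Longrightarrow> F' i u h \<in> Y i"
    and F_deriv: "\<And>i u. i < P \<Longrightarrow> u \<in> dom i \<Longrightarrow> (F i has_derivative F' i u) (at u within dom i)"
    and yt: "\<And>i. i < P \<Longrightarrow> yt i \<in> Y i"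
    and om: "0 < \<omega>" "\<And>k. \<omega> \<le> om k \<and> om k \<le> \<Omega>"
    and lam: "\<And>k. 0 \<le> lam k \<and> lam k \<le> lam_max" "lam_max < 1 / 2"
    and params: "\<rho> > 0" "0 < \<kappa>" "\<kappa> < 1" "\<tau> > 1" "a \<ge> 1"
    and varrho: "varrho > 0" "(1 - lam_max)\<^sup>2 < 1 / (1 + varrho)"
    and c: "c = c_rho \<rho> lam_max varrho \<kappa> \<Omega> L"
    and M: "M = M_const varrho c \<tau> \<Omega> \<eta>"
    and prob: "prob_space Pr"
    and idx_indep: "prob_space.indep_vars Pr (\<lambda>_. count_space {..<P}) idx UNIV"
    and idx_unif: "\<And>k. distr Pr (count_space {..<P}) (idx k) = uniform_count_measure {..<P}"
    and A_cont: "\<And>i. i < P \<Longrightarrow> continuous_on (\<Inter>j<P. dom j) (F i)"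
    and A_ball: "\<And>i. i < P \<Longrightarrow> cball u0 (\<rho> + c) \<subseteq> dom i"
    and A_L: "0 < L" "L \<le> 1 / (2 * \<omega>)"
      "\<And>i u. i < P \<Longrightarrow> u \<in> cball u0 (\<rho> + c) \<Longrightarrow> onorm (F' i u) \<le> L"
    and A_eta: "0 < \<eta>" "\<eta> < 1"
      "\<And>i u v. i < P \<Longrightarrow> u \<in> cball u0 (\<rho> + c) \<Longrightarrow> v \<in> cball u0 (\<rho> + c) \<Longrightarrow>
         norm (F i v - F i u - F' i u (v - u)) \<le> \<eta> * norm (F i v - F i u)"
    and A_sol: "uhat \<in> cball u0 \<rho>" "\<And>i. i < P \<Longrightarrow> F i uhat = yt i"
    and D_pos: "2 * \<omega> * (1 - lam_max) * (1 - \<eta>) - \<Omega>\<^sup>2 * L\<^sup>2 - \<kappa>\<^sup>2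
                 - (1 / \<tau>) * \<Omega> * (2 + M) * (1 + \<eta>) > 0"
    and lam_sum: "summable lam" "(\<Sum>k. lam k) \<le> lam_sum"
  shows
    "(\<forall>dl yd. noisy_data P Y yt dl yd \<and> (\<forall>i<P. norm (yd i - yt i) > 0) \<longrightarrow>
        {w \<in> space Pr. khat P F yt yd \<tau> M a
            (irsgd F F' om lam u0 yd (\<lambda>k. idx k w)) = Some \<infinity>} \<in> sets Pr \<and>
        measure Pr {w \<in> space Pr. khat P F yt yd \<tau> M a
            (irsgd F F' om lam u0 yd (\<lambda>k. idx k w)) = Some \<infinity>} = 0) \<and>
     (\<forall>N::nat. \<exists>\<delta>0>0. \<forall>dl yd.
        noisy_data P Y yt dl yd \<and> (\<forall>i<P. norm (yd i - yt i) > 0) \<and>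
        L2_set dl {..<P} < \<delta>0 \<longrightarrow>
        (\<forall>w\<in>space Pr. \<forall>n. khat P F yt yd \<tau> M a
            (irsgd F F' om lam u0 yd (\<lambda>k. idx k w)) = Some n \<longrightarrow> enat N \<le> n))"
proof (intro conjI allI impI)
  interpret prob_space Pr by (rule prob)
  have "0 < \<Omega>" using om(1) om(2)[of 0] by linarith
  \<comment> \<open>For \<open>lam_max = 0\<close> the smallness condition would read
    \<open>1 < 1 / (1 + varrho)\<close>. Positivity of \<open>lam_max\<close> makes
    \<open>c\<close>, and with it \<open>M\<close>, positive.\<close>
  have "lam_max \<noteq> 0" using varrho by (auto simp: field_simps)
  then have lmax: "0 < lam_max" using lam(1)[of 0] by linarith
  have cpos: "0 < c" unfolding c using params lam lmax varrho by (intro c_rho_pos) auto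
  have Mpos: "0 < M"
    unfolding M M_const_def using varrho cpos params \<open>0 < \<Omega>\<close> A_eta by simp
  have idx: "idx k w < P" if "w \<in> space Pr" for k w
  proof -
    have "idx k \<in> measurable Pr (count_space {..<P})"
      using idx_indep by (auto simp: indep_vars_def)
    from measurable_space[OF this that] show ?thesis by simp
  qed
  {
    fix dl yd
    assume noisy: "noisy_data P Y yt dl yd \<and> (\<forall>i<P. norm (yd i - yt i) > 0)"
    have F'_lin: "bounded_linear (F' i u)" if "i < P" "u \<in> cball u0 (\<rho> + c)" for i u
      using F_deriv[OF that(1)] A_ball[OF that(1)] that(2) has_derivative_bounded_linear by blast
    have "\<not> never_stops P F yt yd \<tau> M a (irsgd F F' om lam u0 yd (\<lambda>k. idx k w))"
      if "w \<in> space Pr" for w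
      using irsgd_not_never_stops[where j = "\<lambda>k. idx k w" and uhat = uhat, OF idx[OF that] F'_lin om lam(1)
          lmax lam(2) lam_sum(1) params(1,2) _ params(5) varrho c M A_L(3) A_eta A_sol D_pos]
        noisy params by simp
    \<comment> \<open>The event is empty, which settles both its measurability and its
      probability.\<close>
    then have none: "{w \<in> space Pr. khat P F yt yd \<tau> M a
        (irsgd F F' om lam u0 yd (\<lambda>k. idx k w)) = Some \<infinity>} = {}"
      using khat_infinity_imp_never_stops by blast
    show "{w \<in> space Pr. khat P F yt yd \<tau> M a
        (irsgd F F' om lam u0 yd (\<lambda>k. idx k w)) = Some \<infinity>} \<in> sets Pr"
      unfolding none by simp
    show "measure Pr {w \<in> space Pr. khat P F yt yd \<tau> M a
        (irsgd F F' om lam u0 yd (\<lambda>k. idx k w)) = Some \<infinity>} = 0"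
      unfolding none by simp
  }
  fix N :: nat
  \<comment> \<open>Chosen so that \<open>\<tau> * \<delta>0 = M / (real N + a)\<close>; stopping at
    \<open>n'\<close> below this noise level forces \<open>N < n'\<close>. Component 0, present
    since \<open>P \<ge> 1\<close>, suffices, and an infinite index satisfies the bound
    trivially.\<close>
  define \<delta>0 where "\<delta>0 = M / (\<tau> * (real N + a))"
  have "0 < \<delta>0" using Mpos params by (simp add: \<delta>0_def)
  moreover have "enat N \<le> n" if noisy: "noisy_data P Y yt dl yd" and small: "L2_set dl {..<P} < \<delta>0"
    and n: "khat P F yt yd \<tau> M a u = Some n" for dl yd u n
  proof (cases n)
    case (enat n')
    then have stop: "norm (F 0 (u n') - yd 0) + M / (real n' + a) \<le> \<tau> * norm (yd 0 - yt 0)"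
      using khat_enat_imp_stops_at n P by (fastforce simp: stops_at_def)
    have "norm (yd 0 - yt 0) \<le> dl 0" using noisy P by (simp add: noisy_data_def)
    also have "\<dots> \<le> L2_set dl {..<P}"
    proof -
      have "0 \<le> dl i" if "i < P" for i
        using noisy that norm_ge_zero order_trans unfolding noisy_data_def by blast
      then show ?thesis using P by (intro member_le_L2_set) auto
    qed
    finally have "\<tau> * norm (yd 0 - yt 0) < \<tau> * \<delta>0" using small params by simp
    moreover have "\<tau> * \<delta>0 = M / (real N + a)" using params by (simp add: \<delta>0_def)
    ultimately have "M / (real n' + a) < M / (real N + a)"
      using stop norm_ge_zero[of "F 0 (u n') - yd 0"] by linarith
    then have "real N < real n'" using Mpos params by (simp add: divide_less_cancel field_simps)
    then show ?thesis using enat by simp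
  qed simp
  ultimately show "\<exists>\<delta>0>0. \<forall>dl yd.
        noisy_data P Y yt dl yd \<and> (\<forall>i<P. norm (yd i - yt i) > 0) \<and>
        L2_set dl {..<P} < \<delta>0 \<longrightarrow>
        (\<forall>w\<in>space Pr. \<forall>n. khat P F yt yd \<tau> M a
            (irsgd F F' om lam u0 yd (\<lambda>k. idx k w)) = Some n \<longrightarrow> enat N \<le> n)"
    by blast
qed

end
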